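(* Let $d\ge 2$, let $m\in\mathbb{N}$ and let $\mathbf{G}=\{g_j\}_{j=1}^m\subseteq\mathbb{C}^d$. 1. If $m\le 2d-2$, then $\mathbf{G}$ fails $\Theta$-PR for every $\Theta\subseteq\mathbb{T}$ with $|\Theta|\ge 2$. 2. If $m=2d-1$, then $\mathbf{G}$ fails $\Theta$-PR for every $\Theta\subseteq\mathbb{T}$ with $|\Theta|\ge 3$.
   Context: $\mathbb{T}=\{z\in\mathbb{C}:|z|=1\}$. $\mathbb{C}^d$ carries its standard inner product, linear in the first and conjugate linear in the second argument. For $\Theta\subseteq\mathbb{T}$, $\mathbf{G}\subseteq\mathbb{C}^d$ does $\Theta$-PR (in $\mathbb{C}^d$) if for all $f,h\in\mathbb{C}^d$ the following holds: if for every $g\in\mathbf{G}$ there exists $\theta_g\in\Theta$ with $\langle f,g\rangle=\theta_g\langle h,g\rangle$, then $f=\theta h$ for some $\theta\in\Theta$. $\mathbf{G}$ fails $\Theta$-PR if it does not do $\Theta$-PR. *)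

theory Defs
  imports "Jordan_Normal_Form.Matrix"
begin

abbreviation unit_circle :: "complex set"
  where "unit_circle \<equiv> {z. cmod z = 1}"

text \<open>
  \<open>\<complex>\<^sup>d\<close> is \<^term>\<open>carrier_vec d :: complex vec set\<close>. The product \<open>f \<bullet>c g\<close> is the sum of
  \<open>f $ i * cnj (g $ i)\<close> over \<open>i < d\<close>, hence linear in \<open>f\<close> and conjugate linear in \<open>g\<close>.
\<close>

definition does_PR :: "nat \<Rightarrow> complex set \<Rightarrow> complex vec set \<Rightarrow> bool"
  where "does_PR d \<Theta> G \<longleftrightarrow>
    (\<forall>f \<in> carrier_vec d. \<forall>h \<in> carrier_vec d.
      (\<forall>g \<in> G. \<exists>\<theta> \<in> \<Theta>. f \<bullet>c g = \<theta> * (h \<bullet>c g)) \<longrightarrow> (\<exists>\<theta> \<in> \<Theta>. f = \<theta> \<cdot>\<^sub>v h))"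

abbreviation fails_PR :: "nat \<Rightarrow> complex set \<Rightarrow> complex vec set \<Rightarrow> bool"
  where "fails_PR d \<Theta> G \<equiv> \<not> does_PR d \<Theta> G"

text \<open>
  The cardinality \<open>|A|\<close> is at least \<open>k\<close>. Infinite sets are treated separately because
  \<^const>\<open>card\<close> is 0 on them.
\<close>
definition card_at_least :: "nat \<Rightarrow> 'a set \<Rightarrow> bool"
  where "card_at_least k A \<longleftrightarrow> infinite A \<or> k \<le> card A"

end

theory Submission
  imports Defs "Jordan_Normal_Form.Determinant"
begin

text \<open>
  If \<open>u\<close> and \<open>v\<close> are linearly independent and \<open>a \<noteq> b\<close> lie in \<open>\<Theta>\<close>, then \<open>f = b u - a v\<close> and
  \<open>h = u - v\<close> satisfy \<open>f - \<theta> h = (b - \<theta>) u - (a - \<theta>) v\<close>. So \<open>f\<close> is no multiple of \<open>h\<close> by an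
  element of \<open>\<Theta>\<close>, while \<open>\<langle>f, g\<rangle> = a \<langle>h, g\<rangle>\<close> for \<open>g\<close> orthogonal to \<open>u\<close> and
  \<open>\<langle>f, g\<rangle> = b \<langle>h, g\<rangle>\<close> for \<open>g\<close> orthogonal to \<open>v\<close>. At most \<open>2d - 2\<close> vectors split into two
  parts, each with a nonzero orthogonal vector. A third phase \<open>c\<close> takes care of one further vector
  \<open>g\<close>: rescaling \<open>u\<close> makes \<open>f - c h\<close> orthogonal to \<open>g\<close>, provided neither \<open>u\<close> nor \<open>v\<close> is. That is
  achieved by taking \<open>g\<close> from a minimal subset of the frame with trivial orthogonal complement.
  If \<open>u\<close> and \<open>v\<close> happen to be dependent, they are orthogonal to all vectors except \<open>g\<close>, and
  splitting off \<open>g\<close> gives the two parts required before.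
\<close>

section \<open>Orthogonal complements\<close>

text \<open>For \<open>S \<subseteq> carrier_vec d\<close> this expresses that \<open>S\<close> does
  not span the space.\<close>

definition has_orth :: "nat \<Rightarrow> complex vec set \<Rightarrow> bool"
  where "has_orth d S \<longleftrightarrow> (\<exists>u \<in> carrier_vec d. u \<noteq> 0\<^sub>v d \<and> (\<forall>g \<in> S. u \<bullet>c g = 0))"

text \<open>Orthogonality to \<open>S\<close> is a homogeneous linear system with fewer than
  \<open>d\<close> equations. Padding it with zero rows gives a singular square matrix, and
  \<open>u\<close> is taken from its kernel.\<close>

lemma has_orth_if_card_less:
  assumes S: "S \<subseteq> carrier_vec d" "finite S" and card: "card S < d"
  shows "has_orth d S"
proof -
  obtain xs where xs: "set xs = S" "distinct xs"
    using finite_distinct_list[OF S(2)] by blast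
  have len: "length xs < d"
    using card xs distinct_card by metis
  have dim: "xs ! i \<in> carrier_vec d" if "i < length xs" for i
    using that S(1) xs(1) nth_mem by blast
  define c where "c i = (if i < length xs then conjugate (xs ! i) else 0\<^sub>v d)" for i
  \<comment> \<open>Row \<open>length xs\<close> is already zero by the default in \<open>c\<close>;
    the redundant \<open>if\<close> matches the form of \<open>det_row_0\<close>.\<close>
  define M where "M = mat\<^sub>r d d (\<lambda>i. if i = length xs then 0\<^sub>v d else c i)"
  have M: "M \<in> carrier_mat d d"
    by (simp add: M_def)
  have row: "row M i = conjugate (xs ! i)" if "i < length xs" for i
    using that len dim[OF that] by (simp add: M_def c_def)
  have "det M = 0"
    unfolding M_def using len dim by (intro det_row_0) (auto simp: c_def)
  then obtain u where u: "u \<in> carrier_vec d" "u \<noteq> 0\<^sub>v d" "M *\<^sub>v u = 0\<^sub>v d"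
    using det_0_iff_vec_prod_zero_field[OF M] by blast
  have "u \<bullet>c (xs ! i) = 0" if i: "i < length xs" for i
  proof -
    have "u \<bullet>c (xs ! i) = conjugate (xs ! i) \<bullet> u"
      using u(1) dim[OF i] by (intro comm_scalar_prod[of _ d]) auto
    also have "\<dots> = (M *\<^sub>v u) $ i"
      using row[OF i] i len M by simp
    also have "\<dots> = 0"
      using u(3) i len by simp
    finally show ?thesis .
  qed
  then show ?thesis
    unfolding has_orth_def using u xs(1) by (metis in_set_conv_nth)
qed

section \<open>Pairs violating phase retrieval\<close>

text \<open>The violating pair is \<open>u\<close> and the zero vector: all their measurements
  vanish, so any phase fits.\<close>

lemma fails_PR_if_has_orth:
  assumes "has_orth d G" and "\<Theta> \<noteq> {}" and "G \<subseteq> carrier_vec d"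
  shows "fails_PR d \<Theta> G"
proof
  assume PR: "does_PR d \<Theta> G"
  obtain u where u: "u \<in> carrier_vec d" "u \<noteq> 0\<^sub>v d" "\<forall>g \<in> G. u \<bullet>c g = 0"
    using assms(1) unfolding has_orth_def by blast
  have "0\<^sub>v d \<bullet>c g = 0" if "g \<in> G" for g
    using that assms(3) by (intro scalar_prod_left_zero) auto
  then have "\<forall>g \<in> G. \<exists>\<theta> \<in> \<Theta>. u \<bullet>c g = \<theta> * (0\<^sub>v d \<bullet>c g)"
    using u(3) assms(2) by auto
  then obtain \<theta> where "u = \<theta> \<cdot>\<^sub>v 0\<^sub>v d"
    using PR u(1) unfolding does_PR_def by (meson zero_carrier_vec)
  then have "u = 0\<^sub>v d"
    by (intro eq_vecI) simp_all
  then show False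
    using u(2) by simp
qed

text \<open>The condition on \<open>g\<close> is
  \<open>f \<bullet>c g = \<theta> * (h \<bullet>c g)\<close> rearranged, so that each
  \<open>g\<close> may choose its own phase.\<close>

lemma fails_PR_if_independent:
  assumes uv: "u \<in> carrier_vec d" "v \<in> carrier_vec d" "v \<noteq> 0\<^sub>v d" "\<And>k. u \<noteq> k \<cdot>\<^sub>v v"
    and ab: "a \<noteq> b"
    and G: "G \<subseteq> carrier_vec d"
      "\<And>g. g \<in> G \<Longrightarrow> \<exists>\<theta> \<in> \<Theta>. (b - \<theta>) * (u \<bullet>c g) = (a - \<theta>) * (v \<bullet>c g)"
  shows "fails_PR d \<Theta> G"
proof
  assume PR: "does_PR d \<Theta> G"
  define f h where "f = b \<cdot>\<^sub>v u - a \<cdot>\<^sub>v v" and "h = u - v"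
  have fh: "f \<in> carrier_vec d" "h \<in> carrier_vec d"
    using uv by (auto simp: f_def h_def)
  have "\<exists>\<theta> \<in> \<Theta>. f \<bullet>c g = \<theta> * (h \<bullet>c g)" if g: "g \<in> G" for g
  proof -
    have gc: "conjugate g \<in> carrier_vec d"
      using g G(1) by auto
    have fg: "f \<bullet>c g = b * (u \<bullet>c g) - a * (v \<bullet>c g)" and hg: "h \<bullet>c g = u \<bullet>c g - v \<bullet>c g"
      using uv gc by (simp_all add: f_def h_def minus_scalar_prod_distrib[of _ d])
    obtain \<theta> where \<theta>: "\<theta> \<in> \<Theta>" "(b - \<theta>) * (u \<bullet>c g) = (a - \<theta>) * (v \<bullet>c g)"
      using G(2)[OF g] by blast
    have "f \<bullet>c g - \<theta> * (h \<bullet>c g) = (b - \<theta>) * (u \<bullet>c g) - (a - \<theta>) * (v \<bullet>c g)"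
      unfolding fg hg by (simp only: algebra_simps)
    also have "\<dots> = 0"
      unfolding \<theta>(2) by (rule diff_self)
    finally have "f \<bullet>c g = \<theta> * (h \<bullet>c g)"
      by (simp only: right_minus_eq)
    then show ?thesis
      using \<theta>(1) by (rule bexI)
  qed
  then obtain \<theta> where eq: "f = \<theta> \<cdot>\<^sub>v h"
    using PR fh unfolding does_PR_def by meson
  have comp: "(b - \<theta>) * u $ i = (a - \<theta>) * v $ i" if "i < d" for i
  proof -
    have "f $ i = \<theta> * h $ i"
      using eq fh that by simp
    then show ?thesis
      using uv that by (simp add: f_def h_def algebra_simps)
  qed
  show False
  \<comment> \<open>For \<open>\<theta> = b\<close> the coefficient of \<open>u\<close> vanishes and
    \<open>(a - b) v = 0\<close> remains; otherwise one can solve for \<open>u\<close>.\<close>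
  proof (cases "\<theta> = b")
    case True
    then have "v = 0\<^sub>v d"
      using comp ab uv by (intro eq_vecI) auto
    then show False
      using uv(3) by simp
  next
    case False
    then have "u = ((a - \<theta>) / (b - \<theta>)) \<cdot>\<^sub>v v"
      using comp uv(1,2) by (intro eq_vecI) (auto simp: field_simps)
    then show False
      using uv(4) by blast
  qed
qed

text \<open>A multiple of \<open>v\<close> inherits orthogonality to \<open>B\<close>, so
  \<open>u\<close> would be orthogonal to all of \<open>A \<union> B\<close>.\<close>

lemma not_smult_if_not_has_orth:
  assumes "\<not> has_orth d (A \<union> B)" and "A \<subseteq> carrier_vec d" "B \<subseteq> carrier_vec d"
    and u: "u \<in> carrier_vec d" "u \<noteq> 0\<^sub>v d" "\<And>g. g \<in> A \<Longrightarrow> u \<bullet>c g = 0"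
    and v: "v \<in> carrier_vec d" "\<And>g. g \<in> B \<Longrightarrow> v \<bullet>c g = 0"
  shows "u \<noteq> k \<cdot>\<^sub>v v"
proof
  assume eq: "u = k \<cdot>\<^sub>v v"
  have "u \<bullet>c g = 0" if "g \<in> B" for g
    using that v assms(3) unfolding eq by (subst smult_scalar_prod_distrib[of _ d]) auto
  then have "has_orth d (A \<union> B)"
    unfolding has_orth_def using u by blast
  then show False
    using assms(1) by simp
qed

lemma fails_PR_if_split:
  assumes G: "A \<union> B \<subseteq> carrier_vec d" and "has_orth d A" "has_orth d B"
    and \<Theta>: "a \<in> \<Theta>" "b \<in> \<Theta>" "a \<noteq> b"
  shows "fails_PR d \<Theta> (A \<union> B)"
proof (cases "has_orth d (A \<union> B)")
  case True
  then show ?thesis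
    using fails_PR_if_has_orth G \<Theta>(1) by blast
next
  case False
  obtain u where u: "u \<in> carrier_vec d" "u \<noteq> 0\<^sub>v d" "\<And>g. g \<in> A \<Longrightarrow> u \<bullet>c g = 0"
    using assms(2) unfolding has_orth_def by blast
  obtain v where v: "v \<in> carrier_vec d" "v \<noteq> 0\<^sub>v d" "\<And>g. g \<in> B \<Longrightarrow> v \<bullet>c g = 0"
    using assms(3) unfolding has_orth_def by blast
  have AB: "A \<subseteq> carrier_vec d" "B \<subseteq> carrier_vec d"
    using G by auto
  show ?thesis
  proof (rule fails_PR_if_independent[OF u(1) v(1,2) _ \<Theta>(3) G])
    show "u \<noteq> k \<cdot>\<^sub>v v" for k
      using not_smult_if_not_has_orth[OF False AB u v(1,3)] .
    show "\<exists>\<theta> \<in> \<Theta>. (b - \<theta>) * (u \<bullet>c g) = (a - \<theta>) * (v \<bullet>c g)" if "g \<in> A \<union> B" for g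
      using that
    proof
      assume "g \<in> A"
      then show ?thesis
        using \<Theta>(1) u(3) by (intro bexI[of _ a]) simp_all
    next
      assume "g \<in> B"
      then show ?thesis
        using \<Theta>(2) v(3) by (intro bexI[of _ b]) simp_all
    qed
  qed
qed

section \<open>Counting for the two bounds\<close>

lemma fails_PR_if_card_le:
  assumes G: "G \<subseteq> carrier_vec d" "finite G" "card G \<le> 2 * d - 2" and "d \<ge> 1"
    and \<Theta>: "a \<in> \<Theta>" "b \<in> \<Theta>" "a \<noteq> b"
  shows "fails_PR d \<Theta> G"
proof -
  \<comment> \<open>The minimum covers a \<open>G\<close> with fewer than \<open>d - 1\<close>
    elements; either way at most \<open>d - 1\<close> remain outside \<open>A\<close>.\<close>
  obtain A where A: "A \<subseteq> G" "card A = min (d - 1) (card G)"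
    using obtain_subset_with_card_n[of "min (d - 1) (card G)" G] by auto
  have "card (G - A) < d"
    using A G \<open>d \<ge> 1\<close> by (simp add: card_Diff_subset finite_subset)
  moreover have "card A < d"
    using A(2) \<open>d \<ge> 1\<close> by simp
  ultimately have "has_orth d A" "has_orth d (G - A)"
    using A G by (auto intro!: has_orth_if_card_less intro: finite_subset)
  moreover have "A \<union> (G - A) = G"
    using A by auto
  ultimately show ?thesis
    using fails_PR_if_split[of A "G - A" d a \<Theta> b] G(1) \<Theta> by simp
qed

lemma fails_PR_if_card_less:
  assumes G: "G \<subseteq> carrier_vec d" "finite G" "card G < 2 * d" and d: "d \<ge> 2"
    and \<Theta>: "a \<in> \<Theta>" "b \<in> \<Theta>" "c \<in> \<Theta>" "a \<noteq> b" "a \<noteq> c" "b \<noteq> c"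
  shows "fails_PR d \<Theta> G"
proof (cases "has_orth d G")
  case True
  then show ?thesis
    using fails_PR_if_has_orth[OF True _ G(1)] \<Theta>(1) by blast
next
  case False
  obtain S where S: "S \<subseteq> G" "\<not> has_orth d S"
    and minimal: "\<And>T. T \<subset> S \<Longrightarrow> has_orth d T"
  proof -
    define F where "F = {S. S \<subseteq> G \<and> \<not> has_orth d S}"
    have "finite F" "G \<in> F"
      using G(2) False by (simp_all add: F_def)
    then obtain S where S: "S \<in> F" "\<And>T. T \<in> F \<Longrightarrow> T \<subseteq> S \<Longrightarrow> S = T"
      using finite_has_minimal[of F] by blast
    show thesis
    proof (rule that)
      show "S \<subseteq> G" "\<not> has_orth d S"
        using S(1) by (simp_all add: F_def)
      show "has_orth d T" if "T \<subset> S" for T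
        using S(2)[of T] that \<open>S \<subseteq> G\<close> unfolding F_def by blast
    qed
  qed
  have fin: "finite S" and sub: "S \<subseteq> carrier_vec d"
    using S(1) G(1,2) finite_subset by (blast, blast)
  \<comment> \<open>A spanning set has at least \<open>d\<close> elements, leaving at most
    \<open>d - 1\<close> for \<open>G - S\<close>.\<close>
  have "card S \<ge> d"
    using has_orth_if_card_less[OF sub fin] S(2) by linarith
  then have "card (G - S) < d"
    using G(3) d card_Diff_subset[OF fin S(1)] by linarith
  then have "has_orth d (G - S)"
    using G(1,2) by (intro has_orth_if_card_less) auto
  then obtain v where v: "v \<in> carrier_vec d" "v \<noteq> 0\<^sub>v d" "\<And>g. g \<in> G - S \<Longrightarrow> v \<bullet>c g = 0"
    unfolding has_orth_def by blast
  then obtain g where g: "g \<in> S" "v \<bullet>c g \<noteq> 0"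
    using S(2) unfolding has_orth_def by blast
  have G_eq: "{g} \<union> (G - {g}) = G"
    using g(1) S(1) by auto
  show ?thesis
  \<comment> \<open>Only in the first case can \<open>u\<close> and \<open>v\<close> be dependent;
    there \<open>{g}\<close> is the other part, as \<open>1 < d\<close>.\<close>
  proof (cases "has_orth d (G - {g})")
    case True
    moreover have "has_orth d {g}"
      using g S G d by (intro has_orth_if_card_less) auto
    ultimately show ?thesis
      using fails_PR_if_split[of "{g}" "G - {g}" d a \<Theta> b, unfolded G_eq, OF G(1)] \<Theta>(1,2,4) by blast
  next
    case no_orth: False
    have "has_orth d (S - {g})"
      using g(1) by (intro minimal) auto
    then obtain u where u: "u \<in> carrier_vec d" "u \<noteq> 0\<^sub>v d" "\<And>x. x \<in> S - {g} \<Longrightarrow> u \<bullet>c x = 0"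
      unfolding has_orth_def by blast
    have ug: "u \<bullet>c g \<noteq> 0"
      using u S(2) unfolding has_orth_def by blast
    \<comment> \<open>This scaling solves the condition at \<open>g\<close> for the phase
      \<open>c\<close>; it is nonzero because \<open>a \<noteq> c\<close> and
      \<open>v \<bullet>c g \<noteq> 0\<close>.\<close>
    define s where "s = (a - c) * (v \<bullet>c g) / ((b - c) * (u \<bullet>c g))"
    have s: "s \<noteq> 0" "(b - c) * (s * (u \<bullet>c g)) = (a - c) * (v \<bullet>c g)"
      using g(2) ug \<Theta> by (auto simp: s_def)
    have su: "(s \<cdot>\<^sub>v u) \<bullet>c x = s * (u \<bullet>c x)" if "x \<in> G" for x
      using that u(1) G(1) by (intro smult_scalar_prod_distrib[of _ d]) auto
    have su_orth: "(s \<cdot>\<^sub>v u) \<bullet>c x = 0" if "x \<in> S - {g}" for x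
      using su[of x] u(3)[OF that] that S(1) by auto
    have su_nz: "s \<cdot>\<^sub>v u \<noteq> 0\<^sub>v d"
    proof
      assume "s \<cdot>\<^sub>v u = 0\<^sub>v d"
      moreover have "g \<in> G" "0\<^sub>v d \<bullet>c g = 0"
        using g(1) S(1) G(1) by (auto intro!: scalar_prod_left_zero)
      ultimately show False
        using su[of g] s(1) ug by simp
    qed
    have "(S - {g}) \<union> (G - S) = G - {g}"
      using g(1) S(1) by auto
    then have no_orth': "\<not> has_orth d ((S - {g}) \<union> (G - S))"
      using no_orth by simp
    have parts: "S - {g} \<subseteq> carrier_vec d" "G - S \<subseteq> carrier_vec d"
      using S(1) G(1) by auto
    have su_carrier: "s \<cdot>\<^sub>v u \<in> carrier_vec d"
      using u(1) by simp
    show ?thesis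
    proof (rule fails_PR_if_independent[OF su_carrier v(1,2) _ \<Theta>(4) G(1)])
      show "s \<cdot>\<^sub>v u \<noteq> k \<cdot>\<^sub>v v" for k
        using not_smult_if_not_has_orth[OF no_orth' parts su_carrier su_nz su_orth v(1,3)] .
      show "\<exists>\<theta> \<in> \<Theta>. (b - \<theta>) * ((s \<cdot>\<^sub>v u) \<bullet>c x) = (a - \<theta>) * (v \<bullet>c x)" if x: "x \<in> G" for x
      proof -
        consider "x = g" | "x \<in> S - {g}" | "x \<in> G - S"
          using x by blast
        then show ?thesis
        proof cases
          case 1
          then show ?thesis
            using \<Theta>(3) s(2) su[OF x] by (intro bexI[of _ c]) simp_all
        next
          case 2
          then show ?thesis
            using \<Theta>(1) su_orth[OF 2] by (intro bexI[of _ a]) simp_all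
        next
          case 3
          then show ?thesis
            using \<Theta>(2) v(3)[OF 3] by (intro bexI[of _ b]) simp_all
        qed
      qed
    qed
  qed
qed

lemma card_at_least_obtain_subset:
  assumes "card_at_least k A"
  obtains B where "B \<subseteq> A" "card B = k"
  using assms infinite_arbitrarily_large[of A k] obtain_subset_with_card_n[of k A]
  unfolding card_at_least_def by metis

theorem theorem1p8:
  fixes d m :: nat and g :: "nat \<Rightarrow> complex vec" and G :: "complex vec set"
  assumes "d \<ge> 2"
    and "G = g ` {1..m}"
    and "G \<subseteq> carrier_vec d"
  shows "(m \<le> 2 * d - 2 \<longrightarrow>
      (\<forall>\<Theta>. \<Theta> \<subseteq> unit_circle \<and> card_at_least 2 \<Theta> \<longrightarrow> fails_PR d \<Theta> G)) \<and>
    (m = 2 * d - 1 \<longrightarrow>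
      (\<forall>\<Theta>. \<Theta> \<subseteq> unit_circle \<and> card_at_least 3 \<Theta> \<longrightarrow> fails_PR d \<Theta> G))"
proof -
  \<comment> \<open>Repetitions among the \<open>g j\<close> can only make \<open>G\<close> smaller,
    hence upper bounds on \<open>card G\<close> in the counting lemmas.\<close>
  have fin: "finite G" and card: "card G \<le> m"
    using assms(2) card_image_le[of "{1..m}" g] by auto
  have "fails_PR d \<Theta> G" if m: "m \<le> 2 * d - 2" and \<Theta>: "card_at_least 2 \<Theta>" for \<Theta>
  proof -
    obtain a b where "a \<in> \<Theta>" "b \<in> \<Theta>" "a \<noteq> b"
      using card_at_least_obtain_subset[OF \<Theta>] card_2_iff by (metis insert_subset)
    then show ?thesis
      using m card fin assms by (intro fails_PR_if_card_le[of G d a \<Theta> b]) auto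
  qed
  moreover have "fails_PR d \<Theta> G" if m: "m = 2 * d - 1" and \<Theta>: "card_at_least 3 \<Theta>" for \<Theta>
  proof -
    obtain a b c where "a \<in> \<Theta>" "b \<in> \<Theta>" "c \<in> \<Theta>" "a \<noteq> b" "a \<noteq> c" "b \<noteq> c"
      using card_at_least_obtain_subset[OF \<Theta>] card_3_iff by (metis insert_subset)
    then show ?thesis
      using m card fin assms by (intro fails_PR_if_card_less[of G d a \<Theta> b c]) auto
  qed
  ultimately show ?thesis
    by blast
qed

end
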